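(* Let $d\geq 1$ be an integer, let $r\geq 0$, and let $\rho$ be a Borel probability measure on $\mathbb{R}^{d}$ with support included in $\mathcal{B}_{r}$. For every integer $n\geq 1$, there exist points $x_{1},\dots,x_{n}\in\mathbb{R}^{d}$, with associated empirical measure $\mu^{(n)}=n^{-1}\sum_{k=1}^{n}\delta_{x_{k}}$, such that for all real $p\geq 1$, $$W_{p}(\mu^{(n)},\rho)\leq 4r\,f_{p,d}(n),$$ where (i) if $p<d$, then $f_{p,d}(n):=\left(\frac{d}{d-p}\right)^{1/p}n^{-1/d}$; (ii) if $p=d$, then $f_{p,d}(n):=\left(\frac{1+\ln n}{n}\right)^{1/d}$; (iii) if $p>d$, then $f_{p,d}(n):=\zeta(p/d)\,n^{-1/p}$, where $\zeta$ is the Riemann zeta function.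
   Context: $\mathbb{R}^{d}$ is equipped with the maximum norm $\|\cdot\|$, and $\mathcal{B}_{r}:=[-r,r]^{d}$ is the closed ball of radius $r$ centered at $0$. For $p\geq 1$ and Borel probability measures $\rho,\mu$ on $\mathbb{R}^{d}$ with finite $p$-th moment ($\int\|x\|^{p}\rho(dx)<+\infty$, and likewise for $\mu$), the Wasserstein distance of order $p$ is $$W_{p}(\rho,\mu):=\left(\inf_{\pi}\int_{(\mathbb{R}^{d})^{2}}\|x-y\|^{p}\,\pi(dx,dy)\right)^{1/p},$$ where the infimum is over all couplings $\pi$ of $\rho$ and $\mu$. *)

theory Defs
  imports "HOL-Probability.Probability"
begin

text \<open>
  The space \<open>\<real>\<^sup>d\<close> is the type \<open>real ^ 'd\<close> with \<open>d = CARD('d)\<close>. Its library norm is the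
  Euclidean one, so the maximum norm is written \<^const>\<open>infnorm\<close> throughout.
\<close>

definition max_cball :: "real \<Rightarrow> (real ^ 'd::finite) set" where
  "max_cball r = {x. \<forall>i. x $ i \<in> {-r..r}}"

lemma max_cball_eq_infnorm: "max_cball r = {x. infnorm x \<le> r}"
  by (auto simp: max_cball_def infnorm_Max Basis_vec_def inner_axis abs_le_iff)
    (metis minus_le_iff)+

definition measure_support :: "'a::topological_space measure \<Rightarrow> 'a set" where
  "measure_support M = {x. \<forall>U. open U \<and> x \<in> U \<longrightarrow> emeasure M U > 0}"

definition couplings ::
    "'a::topological_space measure \<Rightarrow> 'a measure \<Rightarrow> ('a \<times> 'a) measure set" where
  "couplings \<rho> \<mu> =
     {\<pi>. sets \<pi> = sets (borel \<Otimes>\<^sub>M borel) \<and> distr \<pi> borel fst = \<rho> \<and> distr \<pi> borel snd = \<mu>}"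

definition ennreal_root :: "real \<Rightarrow> ennreal \<Rightarrow> ennreal" where
  "ennreal_root p a = (if a = \<infinity> then \<infinity> else ennreal (enn2real a powr (1 / p)))"

text \<open>
  The distance takes extended values, so it needs no moment condition to be defined; for Borel
  probability measures with finite \<open>p\<close>-th moments it is finite. An upper bound on it by a real
  number includes the finiteness of the infimum.
\<close>

definition wasserstein ::
    "real \<Rightarrow> (real ^ 'd::finite) measure \<Rightarrow> (real ^ 'd) measure \<Rightarrow> ennreal" where
  "wasserstein p \<rho> \<mu> =
     ennreal_root p (INF \<pi> \<in> couplings \<rho> \<mu>.
       \<integral>\<^sup>+ (x, y). ennreal (infnorm (x - y) powr p) \<partial>\<pi>)"

definition empirical_measure :: "nat \<Rightarrow> (nat \<Rightarrow> 'a::topological_space) \<Rightarrow> 'a measure" where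
  "empirical_measure n x =
     measure_of UNIV (sets borel)
       (\<lambda>A. ennreal (1 / real n) * (\<Sum>k = 1..n. emeasure (return borel (x k)) A))"

text \<open>
  \<^const>\<open>measure_of\<close> yields the null measure unless its argument is countably additive; the
  following lemma confirms that the weighted sum of Dirac measures is.
\<close>

lemma emeasure_empirical_measure:
  assumes "A \<in> sets borel"
  shows "emeasure (empirical_measure n x) A =
    ennreal (1 / real n) * (\<Sum>k = 1..n. emeasure (return borel (x k)) A)"
proof (rule emeasure_measure_of[OF empirical_measure_def])
  let ?m = "\<lambda>A. ennreal (1 / real n) * (\<Sum>k = 1..n. emeasure (return borel (x k)) A)"
  show "positive (sets (empirical_measure n x)) ?m"
    by (simp add: positive_def)
  show "countably_additive (sets (empirical_measure n x)) ?m"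
  proof (rule countably_additiveI)
    fix B :: "nat \<Rightarrow> 'a set"
    assume B: "range B \<subseteq> sets (empirical_measure n x)" "disjoint_family B"
    then have "range B \<subseteq> sets borel"
      by (simp add: empirical_measure_def sets.sigma_sets_eq[of borel, simplified])
    then have "(\<Sum>i. emeasure (return borel (x k)) (B i)) =
        emeasure (return borel (x k)) (\<Union>i. B i)" for k
      using B(2) by (intro suminf_emeasure) auto
    then show "(\<Sum>i. ?m (B i)) = ?m (\<Union>i. B i)"
      by (simp add: ennreal_suminf_cmult suminf_sum)
  qed
qed (use assms in \<open>auto simp: empirical_measure_def sets.sigma_sets_eq[of borel, simplified]\<close>)

lemma sets_empirical_measure: "sets (empirical_measure n x) = sets borel"
  by (simp add: empirical_measure_def sets.sigma_sets_eq[of borel, simplified])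

text \<open>The Dirichlet series of the Riemann zeta function; meaningful for real \<open>s > 1\<close> only.\<close>

definition riemann_zeta :: "real \<Rightarrow> real" where
  "riemann_zeta s = (\<Sum>k. 1 / real (Suc k) powr s)"

lemma riemann_zeta_summable:
  assumes "s > 1"
  shows "summable (\<lambda>k. 1 / real (Suc k) powr s)"
proof -
  have "summable (\<lambda>k. real k powr (-s))"
    using assms summable_real_powr_iff[of "-s"] by simp
  then have "summable (\<lambda>k. real (Suc k) powr (-s))"
    by (subst summable_Suc_iff)
  then show ?thesis
    by (simp add: powr_minus_divide)
qed

definition quantization_rate :: "real \<Rightarrow> nat \<Rightarrow> nat \<Rightarrow> real" where
  "quantization_rate p d n =
     (if p < real d then (real d / (real d - p)) powr (1 / p) * real n powr (- (1 / real d))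
      else if p = real d then ((1 + ln (real n)) / real n) powr (1 / real d)
      else riemann_zeta (p / real d) * real n powr (- (1 / p)))"

end

theory Submission
  imports Defs
begin

text \<open>
  The measure \<open>\<rho>\<close> is cut into \<open>n\<close> pieces of mass \<open>1/n\<close>, one after the other. While a
  remainder of mass \<open>k/n\<close> is left, cover the box by at most \<open>k\<close> congruent cubes, of side
  \<open>2r/m\<close> with \<open>m = \<lfloor>k\<^sup>1\<^sup>/\<^sup>d\<rfloor>\<close>. By the pigeonhole principle one of them carries mass at least
  \<open>1/n\<close> of the remainder, so a piece of mass exactly \<open>1/n\<close> can be split off inside this cube
  (\<open>uniform_decomposition\<close>). Since \<open>m \<ge> k\<^sup>1\<^sup>/\<^sup>d / 2\<close>, a point \<open>x\<^sub>k\<close> of the cube is within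
  \<open>4 r k\<^sup>-\<^sup>1\<^sup>/\<^sup>d\<close> of the whole piece (\<open>cube_cover\<close>).

  Transporting each piece to its point \<open>x\<^sub>k\<close> is a coupling of the empirical measure with \<open>\<rho>\<close>
  (\<open>nn_integral_empirical_coupling\<close>), whose \<open>p\<close>-cost is at most
  \<open>(4r)\<^sup>p n\<^sup>-\<^sup>1 (\<Sum>k = 1..n. k\<^sup>-\<^sup>p\<^sup>/\<^sup>d)\<close>. The three regimes of the rate are the three behaviours of
  this partial sum: power growth for \<open>p < d\<close>, logarithmic growth for \<open>p = d\<close>, convergence for
  \<open>p > d\<close> (\<open>root_mean_le_quantization_rate\<close>). The construction of the pieces and points does
  not involve \<open>p\<close>, which is why the same points serve all \<open>p\<close> at once.

  A piece is represented by its density with respect to \<open>\<rho>\<close>, so that splitting off a piece is a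
  subtraction of functions.
\<close>

section \<open>Concentration on the support\<close>

text \<open>
  The complement of the support is a union of open null sets; by the Lindelof property countably
  many of them suffice.
\<close>

lemma AE_in_measure_support:
  fixes M :: "'a::second_countable_topology measure"
  assumes "sets M = sets borel"
  shows "AE x in M. x \<in> measure_support M"
proof -
  let ?\<F> = "{U. open U \<and> emeasure M U = 0}"
  obtain \<G> where \<G>: "\<G> \<subseteq> ?\<F>" "countable \<G>" "\<Union>\<G> = \<Union>?\<F>"
    using Lindelof[of ?\<F>] by blast
  have "(\<Union>U\<in>\<G>. U) \<in> null_sets M"
    using \<G> assms by (intro null_sets_UN') (auto intro!: null_setsI)
  moreover have "{x \<in> space M. x \<notin> measure_support M} \<subseteq> (\<Union>U\<in>\<G>. U)"
    using \<G>(3) by (auto simp: measure_support_def zero_less_iff_neq_zero)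
  ultimately show ?thesis
    by (rule AE_I')
qed

section \<open>Decomposition into pieces of equal mass\<close>

text \<open>
  The pigeonhole principle for mass: the member of largest mass has at least the average mass. The
  sets may overlap, which only increases the sum of their masses.
\<close>

lemma exists_heavy_member:
  fixes h :: "'a \<Rightarrow> ennreal"
  assumes \<C>: "finite \<C>" "card \<C> \<le> k" "\<C> \<subseteq> sets M" "AE y in M. y \<in> \<Union>\<C>"
    and h: "h \<in> borel_measurable M" "integral\<^sup>N M h = of_nat k * ennreal c"
    and pos: "c > 0" "k > 0"
  shows "\<exists>C\<in>\<C>. ennreal c \<le> (\<integral>\<^sup>+y. h y * indicator C y \<partial>M)"
proof -
  have [measurable]: "h \<in> borel_measurable M" "\<And>C. C \<in> \<C> \<Longrightarrow> C \<in> sets M"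
    using h(1) \<C>(3) by auto
  have "of_nat k * ennreal c \<le> (\<integral>\<^sup>+y. (\<Sum>C\<in>\<C>. h y * indicator C y) \<partial>M)"
    unfolding h(2)[symmetric]
  proof (rule nn_integral_mono_AE)
    show "AE y in M. h y \<le> (\<Sum>C\<in>\<C>. h y * indicator C y)"
      using \<C>(4)
    proof eventually_elim
      case (elim y)
      then obtain C where "C \<in> \<C>" "y \<in> C" by blast
      then show ?case
        using member_le_sum[of C \<C> "\<lambda>C. h y * indicator C y"] \<C>(1) by simp
    qed
  qed
  also have "\<dots> = (\<Sum>C\<in>\<C>. \<integral>\<^sup>+y. h y * indicator C y \<partial>M)"
    by (intro nn_integral_sum) measurable
  finally have le: "of_nat k * ennreal c \<le> (\<Sum>C\<in>\<C>. \<integral>\<^sup>+y. h y * indicator C y \<partial>M)" .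
  have kc: "of_nat k * ennreal c > 0" and k: "(of_nat k :: ennreal) > 0"
    using pos by (simp_all add: ennreal_zero_less_mult_iff)
  with le have "\<C> \<noteq> {}" by auto
  let ?I = "\<lambda>C. \<integral>\<^sup>+y. h y * indicator C y \<partial>M"
  from \<open>\<C> \<noteq> {}\<close> \<C>(1) have "Max (?I ` \<C>) \<in> ?I ` \<C>" by (intro Max_in) auto
  then obtain C where C: "C \<in> \<C>" "?I C = Max (?I ` \<C>)" by force
  have "(\<Sum>D\<in>\<C>. ?I D) \<le> of_nat (card \<C>) * ?I C"
    using \<C>(1) C by (intro sum_bounded_above) auto
  also have "\<dots> \<le> of_nat k * ?I C"
    using \<C>(2) by (intro mult_right_mono) auto
  finally have "of_nat k * ennreal c \<le> of_nat k * ?I C" using le by (rule order_trans[rotated])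
  then have "ennreal c \<le> ?I C"
    using k by (simp add: ennreal_mult_le_mult_iff)
  with C(1) show ?thesis by blast
qed

text \<open>
  Rescaling the restriction of \<open>h\<close> to \<open>C\<close> gives it mass \<open>c\<close>; the factor is at most \<open>1\<close> because
  \<open>C\<close> is heavy, so the result stays below \<open>h\<close>.
\<close>

lemma peel_off_piece:
  fixes h :: "'a \<Rightarrow> ennreal"
  assumes C: "C \<in> sets M" and h: "h \<in> borel_measurable M" "integral\<^sup>N M h < \<infinity>"
    and c: "c > 0" "ennreal c \<le> (\<integral>\<^sup>+y. h y * indicator C y \<partial>M)"
  obtains g where "g \<in> borel_measurable M" "integral\<^sup>N M g = ennreal c"
    "\<And>y. g y \<le> h y" "\<And>y. y \<notin> C \<Longrightarrow> g y = 0"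
proof -
  have [measurable]: "h \<in> borel_measurable M" "C \<in> sets M" using C h by auto
  define I where "I = (\<integral>\<^sup>+y. h y * indicator C y \<partial>M)"
  have "I \<le> integral\<^sup>N M h"
    unfolding I_def by (intro nn_integral_mono) (auto simp: indicator_def)
  then have I: "I < \<top>" "I \<noteq> 0" "ennreal c \<le> I"
    using h(2) c by (auto simp: I_def)
  define g where "g = (\<lambda>y. (ennreal c / I) * (h y * indicator C y))"
  show ?thesis
  proof
    show "g \<in> borel_measurable M" unfolding g_def by measurable
    have "integral\<^sup>N M g = (ennreal c / I) * I"
      unfolding g_def I_def by (rule nn_integral_cmult) measurable
    then show "integral\<^sup>N M g = ennreal c"
      using I by (simp add: ennreal_divide_times mult_divide_eq_ennreal)
    have "ennreal c / I \<le> 1"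
      using I by (metis divide_right_mono_ennreal ennreal_divide_self)
    then show "g y \<le> h y" for y
      using mult_right_mono[of "ennreal c / I" 1 "h y"] by (auto simp: g_def indicator_def)
    show "y \<notin> C \<Longrightarrow> g y = 0" for y by (simp add: g_def)
  qed
qed

text \<open>
  The pieces are split off in the order \<open>n, \<dots>, 1\<close>: when the \<open>j\<close>-th one is chosen, \<open>j\<close> units
  of mass remain, and a cover by at most \<open>j\<close> sets has a member carrying a full unit. The covers
  can therefore be fine at first and have to become coarser as mass runs out.
\<close>

lemma uniform_decomposition:
  fixes h :: "'a \<Rightarrow> ennreal"
  assumes \<C>: "\<And>j. j > 0 \<Longrightarrow> finite (\<C> j)" "\<And>j. j > 0 \<Longrightarrow> card (\<C> j) \<le> j"
      "\<And>j. j > 0 \<Longrightarrow> \<C> j \<subseteq> sets M" "\<And>j. j > 0 \<Longrightarrow> AE y in M. y \<in> \<Union>(\<C> j)"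
    and c: "c > 0"
    and h: "h \<in> borel_measurable M" "integral\<^sup>N M h = of_nat n * ennreal c"
  shows "\<exists>C g. (AE y in M. h y = (\<Sum>j=1..n. g j y)) \<and>
    (\<forall>j\<in>{1..n}. C j \<in> \<C> j \<and> g j \<in> borel_measurable M \<and> integral\<^sup>N M (g j) = ennreal c \<and>
      (\<forall>y. y \<notin> C j \<longrightarrow> g j y = 0))"
  using h
proof (induction n arbitrary: h)
  case 0
  then have "AE y in M. h y = 0" by (simp add: nn_integral_0_iff_AE)
  then show ?case by simp
next
  case (Suc n)
  have [measurable]: "h \<in> borel_measurable M" by fact
  have fin: "integral\<^sup>N M h < \<infinity>" 
    unfolding Suc.prems by (simp add: ennreal_mult_less_top of_nat_less_top del: of_nat_Suc)
  obtain D where D: "D \<in> \<C> (Suc n)" "ennreal c \<le> (\<integral>\<^sup>+y. h y * indicator D y \<partial>M)"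
    using exists_heavy_member[OF \<C>[of "Suc n"] Suc.prems c] by auto
  then have "D \<in> sets M" using \<C>(3)[of "Suc n"] by auto
  from peel_off_piece[OF this Suc.prems(1) fin c D(2)]
  obtain f where f: "f \<in> borel_measurable M" "integral\<^sup>N M f = ennreal c"
    "\<And>y. f y \<le> h y" "\<And>y. y \<notin> D \<Longrightarrow> f y = 0" by blast
  have "integral\<^sup>N M (\<lambda>y. h y - f y) = integral\<^sup>N M h - integral\<^sup>N M f"
    using f by (intro nn_integral_diff) auto
  also have "\<dots> = of_nat n * ennreal c"
    unfolding Suc.prems f(2) by (simp add: distrib_right)
  finally have "integral\<^sup>N M (\<lambda>y. h y - f y) = of_nat n * ennreal c" .
  moreover have "(\<lambda>y. h y - f y) \<in> borel_measurable M" using f(1) by measurable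
  ultimately obtain C g where Cg: "AE y in M. h y - f y = (\<Sum>j=1..n. g j y)"
    "\<forall>j\<in>{1..n}. C j \<in> \<C> j \<and> g j \<in> borel_measurable M \<and> integral\<^sup>N M (g j) = ennreal c \<and>
      (\<forall>y. y \<notin> C j \<longrightarrow> g j y = 0)"
    using Suc.IH by blast
  have "AE y in M. h y = (\<Sum>j=1..Suc n. (g(Suc n := f)) j y)"
    using Cg(1)
  proof eventually_elim
    case (elim y)
    have "(\<Sum>j=1..n. (g(Suc n := f)) j y) = (\<Sum>j=1..n. g j y)"
      by (intro sum.cong) auto
    moreover have "h y = (h y - f y) + f y"
      using f(3)[of y] by (simp add: diff_add_cancel_ennreal)
    ultimately show ?case
      unfolding elim by simp
  qed
  then show ?case
    using Cg(2) f D(1)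
    by (intro exI[of _ "C(Suc n := D)"] exI[of _ "g(Suc n := f)"]) (auto simp: le_Suc_eq)
qed

section \<open>Covering the box by small cubes\<close>

text \<open>
  Taking the first cell whose right end is not below \<open>t\<close>, rather than a floor of a quotient by
  \<open>r\<close>, includes the degenerate interval \<open>r = 0\<close>.
\<close>

lemma interval_grid_cell:
  assumes "m > 0" "t \<in> {-r..r::real}"
  shows "\<exists>j<m. -r + 2 * r * real j / real m \<le> t \<and> t \<le> -r + 2 * r * real (Suc j) / real m"
proof -
  define j where "j = (LEAST j. t \<le> -r + 2 * r * real (Suc j) / real m)"
  have last: "t \<le> -r + 2 * r * real (Suc (m - 1)) / real m"
    using assms by simp
  then have "t \<le> -r + 2 * r * real (Suc j) / real m"
    unfolding j_def by (rule LeastI)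
  moreover have "j \<le> m - 1"
    unfolding j_def using last by (rule Least_le)
  moreover have "-r + 2 * r * real j / real m \<le> t"
  proof (cases j)
    case 0
    then show ?thesis using assms by simp
  next
    case (Suc i)
    then have "i < (LEAST j. t \<le> -r + 2 * r * real (Suc j) / real m)"
      by (simp add: j_def)
    from not_less_Least[OF this] show ?thesis by (simp add: Suc)
  qed
  ultimately show ?thesis using assms(1) by (intro exI[of _ j]) auto
qed

lemma infnorm_cart_le:
  fixes x :: "real ^ 'd::finite"
  assumes "\<And>i. \<bar>x $ i\<bar> \<le> a"
  shows "infnorm x \<le> a"
  using assms by (auto simp: infnorm_Max Basis_vec_def inner_axis)

text \<open>
  The cover is the grid with \<open>m = \<lfloor>k\<^sup>1\<^sup>/\<^sup>d\<rfloor>\<close> cells per axis. It has \<open>m\<^sup>d \<le> k\<close> cells, and its mesh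
  \<open>2r/m\<close> is at most \<open>4 r k\<^sup>-\<^sup>1\<^sup>/\<^sup>d\<close> because rounding down a number that is at least \<open>1\<close> loses at
  most a factor \<open>2\<close>.
\<close>

lemma cube_cover:
  fixes r :: real
  assumes "r \<ge> 0" "k > 0"
  shows "\<exists>\<C> :: (real ^ 'd::finite) set set. finite \<C> \<and> card \<C> \<le> k \<and> \<C> \<subseteq> sets borel \<and>
    max_cball r \<subseteq> \<Union>\<C> \<and>
    (\<forall>C\<in>\<C>. \<exists>x. \<forall>y\<in>C. infnorm (x - y) \<le> 4 * r * real k powr (- 1 / real CARD('d)))"
proof -
  define t where "t = real k powr (1 / real CARD('d))"
  define m where "m = nat \<lfloor>t\<rfloor>"
  have "t \<ge> 1" using assms by (simp add: t_def ge_one_powr_ge_zero)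
  then have m: "m \<ge> 1" "real m \<le> t" "t < real m + 1"
    by (simp_all add: m_def le_nat_floor)
  then have t_le: "t \<le> 2 * real m" by simp
  have "real m ^ CARD('d) \<le> t ^ CARD('d)"
    using m by (intro power_mono) auto
  also have "\<dots> = real k"
    using assms by (simp add: t_def powr_realpow[symmetric] powr_powr)
  finally have card_le: "m ^ CARD('d) \<le> k"
    by (metis of_nat_le_iff of_nat_power)
  define corner :: "('d \<Rightarrow> nat) \<Rightarrow> real ^ 'd"
    where "corner f = (\<chi> i. -r + 2 * r * real (f i) / real m)" for f
  define cube :: "('d \<Rightarrow> nat) \<Rightarrow> (real ^ 'd) set"
    where "cube f = cbox (corner f) (corner (\<lambda>i. Suc (f i)))" for f
  define F where "F = (UNIV :: 'd set) \<rightarrow>\<^sub>E {..<m}"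
  have F: "finite F" "card F = m ^ CARD('d)"
    by (auto simp: F_def finite_PiE card_funcsetE)
  have "card (cube ` F) \<le> k"
    using card_image_le[of F cube] F card_le by linarith
  moreover have "max_cball r \<subseteq> \<Union>(cube ` F)"
  proof
    fix y :: "real ^ 'd"
    assume "y \<in> max_cball r"
    then have "\<forall>i. \<exists>j<m. -r + 2 * r * real j / real m \<le> y $ i \<and>
        y $ i \<le> -r + 2 * r * real (Suc j) / real m"
      using m(1) by (intro allI interval_grid_cell) (auto simp: max_cball_def)
    then obtain f where "\<forall>i. f i < m \<and> -r + 2 * r * real (f i) / real m \<le> y $ i \<and>
        y $ i \<le> -r + 2 * r * real (Suc (f i)) / real m"
      by metis
    then have "f \<in> F" "y \<in> cube f"
      by (auto simp: F_def cube_def corner_def mem_box_cart)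
    then show "y \<in> \<Union>(cube ` F)" by blast
  qed
  moreover have "infnorm (corner f - y) \<le> 4 * r * real k powr (- 1 / real CARD('d))"
    if y: "y \<in> cube f" for f y
  proof -
    have "2 * r / real m \<le> 2 * r * (2 / t)"
      using m t_le assms(1) \<open>t \<ge> 1\<close> by (simp add: field_simps mult_left_mono)
    also have "\<dots> = 4 * r * real k powr (- 1 / real CARD('d))"
      by (simp add: t_def powr_minus_divide)
    finally have *: "2 * r / real m \<le> 4 * r * real k powr (- 1 / real CARD('d))" .
    have "\<bar>(corner f - y) $ i\<bar> \<le> 2 * r / real m" for i
    proof -
      have "corner f $ i \<le> y $ i" "y $ i \<le> corner (\<lambda>i. Suc (f i)) $ i"
        using y by (auto simp: cube_def mem_box_cart)
      moreover have "corner (\<lambda>i. Suc (f i)) $ i = corner f $ i + 2 * r / real m"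
        by (simp add: corner_def field_simps add_divide_distrib)
      ultimately show ?thesis by simp
    qed
    with * show ?thesis using infnorm_cart_le order_trans by blast
  qed
  ultimately show ?thesis
    using F(1) by (intro exI[of _ "cube ` F"]) (auto simp: cube_def)
qed

section \<open>The coupling and its cost\<close>

text \<open>
  The coupling is \<open>\<Sum>\<^sub>j \<delta>\<^bsub>x j\<^esub> \<otimes> (g j \<cdot> M)\<close>. It is realised on labelled points \<open>(j, y)\<close>, with
  density \<open>g j y\<close> with respect to counting measure times \<open>M\<close>, and then pushed forward by
  \<open>(j, y) \<mapsto> (x j, y)\<close>. The first marginal is the empirical measure since every piece has mass
  \<open>1/n\<close>, the second is \<open>M\<close> since the densities add up to \<open>1\<close>.
\<close>

lemma nn_integral_empirical_coupling:
  fixes M :: "'a::topological_space measure"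
  assumes M: "prob_space M" "sets M = sets borel"
    and g: "\<And>j. j \<in> {1..n} \<Longrightarrow> g j \<in> borel_measurable M"
      "\<And>j. j \<in> {1..n} \<Longrightarrow> integral\<^sup>N M (g j) = ennreal (1 / real n)"
      "AE y in M. (\<Sum>j=1..n. g j y) = 1"
  shows "\<exists>\<pi> \<in> couplings (empirical_measure n x) M. \<forall>f \<in> borel_measurable (borel \<Otimes>\<^sub>M borel).
    integral\<^sup>N \<pi> f = (\<Sum>j=1..n. \<integral>\<^sup>+y. f (x j, y) * g j y \<partial>M)"
proof -
  interpret prob_space M by fact
  note [measurable_cong] = M(2)
  let ?N = "count_space {1..n} \<Otimes>\<^sub>M M"
  have G: "(\<lambda>(j, y). g j y) \<in> borel_measurable ?N"
    using g(1) by (intro measurable_pair_measure_countable1) auto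
  have X: "(\<lambda>(j, y). (x j, y)) \<in> measurable ?N (borel \<Otimes>\<^sub>M borel)"
    by (intro measurable_pair_measure_countable1) (auto, measurable)
  define \<pi> where "\<pi> = distr (density ?N (\<lambda>(j, y). g j y)) (borel \<Otimes>\<^sub>M borel) (\<lambda>(j, y). (x j, y))"
  have sets_\<pi> [measurable_cong]: "sets \<pi> = sets (borel \<Otimes>\<^sub>M borel)" by (simp add: \<pi>_def)
  have int: "integral\<^sup>N \<pi> f = (\<Sum>j=1..n. \<integral>\<^sup>+y. f (x j, y) * g j y \<partial>M)"
    if f: "f \<in> borel_measurable (borel \<Otimes>\<^sub>M borel)" for f
  proof -
    note fX = measurable_compose[OF X f]
    have "integral\<^sup>N \<pi> f =
        (\<integral>\<^sup>+z. f (case z of (j, y) \<Rightarrow> (x j, y)) \<partial>density ?N (\<lambda>(j, y). g j y))"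
      unfolding \<pi>_def
      by (rule nn_integral_distr) (use X f in \<open>simp_all only: measurable_density_eq1 measurable_distr_eq1\<close>)
    also have "\<dots> = (\<integral>\<^sup>+z. (case z of (j, y) \<Rightarrow> g j y) * f (case z of (j, y) \<Rightarrow> (x j, y)) \<partial>?N)"
      by (rule nn_integral_density[OF G fX])
    also have "\<dots> = (\<integral>\<^sup>+j. \<integral>\<^sup>+y. g j y * f (x j, y) \<partial>M \<partial>count_space {1..n})"
      using nn_integral_fst[OF borel_measurable_times_ennreal[OF G fX]] by (simp only: prod.case)
    finally show ?thesis
      by (simp only: nn_integral_count_space_finite[OF finite_atLeastAtMost] mult.commute[of "f _"])
  qed
  have fst: "distr \<pi> borel fst = empirical_measure n x"
  proof (rule measure_eqI)
    fix A assume "A \<in> sets (distr \<pi> borel fst)"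
    then have A [measurable]: "A \<in> sets borel" by simp
    have "emeasure (distr \<pi> borel fst) A = (\<integral>\<^sup>+z. indicator A z \<partial>distr \<pi> borel fst)"
      by simp
    also have "\<dots> = (\<integral>\<^sup>+z. indicator A (fst z) \<partial>\<pi>)"
      by (rule nn_integral_distr) simp_all
    also have "\<dots> = (\<Sum>j=1..n. indicator A (x j) * integral\<^sup>N M (g j))"
      using g(1) by (subst int) (simp_all add: nn_integral_cmult)
    also have "\<dots> = emeasure (empirical_measure n x) A"
      using A g(2) by (simp add: emeasure_empirical_measure sum_distrib_left mult.commute)
    finally show "emeasure (distr \<pi> borel fst) A = emeasure (empirical_measure n x) A" .
  qed (simp add: sets_empirical_measure)
  have snd: "distr \<pi> borel snd = M"
  proof (rule measure_eqI)
    fix A assume "A \<in> sets (distr \<pi> borel snd)"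
    then have A [measurable]: "A \<in> sets borel" by simp
    have "emeasure (distr \<pi> borel snd) A = (\<integral>\<^sup>+z. indicator A z \<partial>distr \<pi> borel snd)"
      by simp
    also have "\<dots> = (\<integral>\<^sup>+z. indicator A (snd z) \<partial>\<pi>)"
      by (rule nn_integral_distr) simp_all
    also have "\<dots> = (\<Sum>j=1..n. \<integral>\<^sup>+y. indicator A y * g j y \<partial>M)"
      by (subst int) simp_all
    also have "\<dots> = (\<integral>\<^sup>+y. (\<Sum>j=1..n. indicator A y * g j y) \<partial>M)"
      using g(1) by (intro nn_integral_sum[symmetric] borel_measurable_times_ennreal) simp_all
    also have "\<dots> = (\<integral>\<^sup>+y. indicator A y \<partial>M)"
      using g(3) by (intro nn_integral_cong_AE) (auto simp: sum_distrib_left[symmetric])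
    also have "\<dots> = emeasure M A" by simp
    finally show "emeasure (distr \<pi> borel snd) A = emeasure M A" .
  qed (simp add: M)
  show ?thesis
    using sets_\<pi> fst snd int by (intro bexI[of _ \<pi>]) (auto simp: couplings_def)
qed

lemma wasserstein_le_of_coupling:
  fixes \<mu> \<nu> :: "(real ^ 'd::finite) measure"
  assumes "\<pi> \<in> couplings \<mu> \<nu>" "p > 0" "b \<ge> 0"
    and "(\<integral>\<^sup>+ (x, y). ennreal (infnorm (x - y) powr p) \<partial>\<pi>) \<le> ennreal b"
  shows "wasserstein p \<mu> \<nu> \<le> ennreal (b powr (1 / p))"
proof -
  define I where "I = (INF \<pi> \<in> couplings \<mu> \<nu>. \<integral>\<^sup>+ (x, y). ennreal (infnorm (x - y) powr p) \<partial>\<pi>)"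
  have "I \<le> ennreal b"
    unfolding I_def using assms(1,4) by (rule INF_lower2)
  then have "I \<noteq> \<infinity>" "enn2real I \<le> b"
    using assms(3) by (auto simp: top_unique intro: enn2real_leI)
  then show ?thesis
    using assms(2)
    by (auto simp: wasserstein_def ennreal_root_def simp flip: I_def intro!: ennreal_leI powr_mono2)
qed

section \<open>Partial sums of powers and the rate\<close>

text \<open>
  The right-hand side is the integral of \<open>t\<^sup>-\<^sup>s\<close> over \<open>[0, n]\<close>. The comparison of each term with its
  share of the integral is the weighted inequality of arithmetic and geometric means for
  \<open>n + 1\<close> and \<open>n\<close> with weights \<open>s\<close> and \<open>1 - s\<close>.
\<close>

lemma sum_powr_le:
  assumes "0 < s" "s < 1"
  shows "(\<Sum>k=1..n. real k powr (- s)) \<le> real n powr (1 - s) / (1 - s)"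
proof (induction n)
  case (Suc n)
  have "real (Suc n) powr s * real n powr (1 - s) \<le> s * real (Suc n) + (1 - s) * real n"
    using assms by (cases "n = 0") (auto intro!: Youngs_inequality_0)
  then have "real n powr (1 - s) \<le> (real (Suc n) - (1 - s)) * real (Suc n) powr (- s)"
    by (simp add: powr_minus field_simps)
  also have "\<dots> = real (Suc n) powr (1 - s) - (1 - s) * real (Suc n) powr (- s)"
    by (simp add: powr_diff powr_minus field_simps)
  finally have "(real n powr (1 - s) + (1 - s) * real (Suc n) powr (- s)) / (1 - s)
      \<le> real (Suc n) powr (1 - s) / (1 - s)"
    using assms by (intro divide_right_mono) auto
  then have "real n powr (1 - s) / (1 - s) + real (Suc n) powr (- s)
      \<le> real (Suc n) powr (1 - s) / (1 - s)"
    using assms by (simp add: add_divide_distrib)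
  then show ?case using Suc by simp
qed (use assms in simp)

lemma sum_inverse_le:
  assumes "n > 0"
  shows "(\<Sum>k=1..n. real k powr (- 1)) \<le> 1 + ln (real n)"
  using assms
proof (induction n rule: nat_induct_non_zero)
  case (Suc n)
  have "ln (real n / real (Suc n)) \<le> real n / real (Suc n) - 1"
    using Suc.hyps by (intro ln_le_minus_one) auto
  then have "real (Suc n) powr (- 1) \<le> ln (real (Suc n)) - ln (real n)"
    using Suc.hyps by (simp add: ln_div powr_minus field_simps)
  then show ?case using Suc.IH by simp
qed simp

lemma riemann_zeta_partial_sum_le:
  assumes "s > 1"
  shows "(\<Sum>k=1..n. real k powr (- s)) \<le> riemann_zeta s"
proof -
  have "(\<Sum>k=1..n. real k powr (- s)) = (\<Sum>k<n. 1 / real (Suc k) powr s)"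
    by (rule sum.reindex_bij_witness[of _ Suc "\<lambda>k. k - 1"]) (auto simp: powr_minus_divide)
  also have "\<dots> \<le> riemann_zeta s"
    unfolding riemann_zeta_def
    using riemann_zeta_summable[OF assms] by (intro sum_le_suminf) auto
  finally show ?thesis .
qed

text \<open>
  For \<open>p > d\<close> the natural bound has the factor \<open>\<zeta>(p/d)\<^sup>1\<^sup>/\<^sup>p\<close>; it is at most \<open>\<zeta>(p/d)\<close> because
  \<open>\<zeta> \<ge> 1\<close> and \<open>p \<ge> 1\<close>.
\<close>

lemma root_mean_le_quantization_rate:
  assumes p: "p \<ge> 1" and n: "n > 0" and d: "d > 0"
  shows "((\<Sum>k=1..n. real k powr (- (p / real d))) / real n) powr (1 / p) \<le> quantization_rate p d n"
    (is "(?S / _) powr _ \<le> _")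
proof -
  have S: "?S \<ge> 0" by (intro sum_nonneg) auto
  consider "p < real d" | "p = real d" | "p > real d" by linarith
  then show ?thesis
  proof cases
    case 1
    have "?S / real n \<le> (real n powr (1 - p / real d) / (1 - p / real d)) / real n"
      using 1 p n d by (intro divide_right_mono sum_powr_le) auto
    also have "\<dots> = real d / (real d - p) * real n powr (- (p / real d))"
    proof -
      have "real n powr (1 - p / real d) = real n * real n powr (- (p / real d))"
        using n by (simp add: powr_diff powr_minus_divide)
      moreover have "1 - p / real d = (real d - p) / real d"
        using d by (simp add: field_simps)
      ultimately show ?thesis using n by simp
    qed
    finally have "(?S / real n) powr (1 / p)
        \<le> (real d / (real d - p) * real n powr (- (p / real d))) powr (1 / p)"
      using S p by (intro powr_mono2) auto
    also have "\<dots> = quantization_rate p d n"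
      using 1 p n d by (subst powr_mult) (auto simp: quantization_rate_def powr_powr)
    finally show ?thesis .
  next
    case 2
    then have "?S \<le> 1 + ln (real n)"
      using sum_inverse_le[OF n] d by simp
    then have "(?S / real n) powr (1 / p) \<le> ((1 + ln (real n)) / real n) powr (1 / p)"
      using S p by (intro powr_mono2 divide_right_mono) auto
    then show ?thesis using 2 by (simp add: quantization_rate_def)
  next
    case 3
    let ?z = "riemann_zeta (p / real d)"
    have s: "p / real d > 1" using 3 d by simp
    have z: "?z \<ge> 1"
      using riemann_zeta_partial_sum_le[OF s, of 1] by simp
    have "(?S / real n) powr (1 / p) \<le> (?z / real n) powr (1 / p)"
      using S p riemann_zeta_partial_sum_le[OF s, of n]
      by (intro powr_mono2 divide_right_mono) auto
    also have "\<dots> = ?z powr (1 / p) * real n powr (- (1 / p))"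
      using z by (simp add: powr_divide powr_minus_divide)
    also have "\<dots> \<le> ?z * real n powr (- (1 / p))"
      using powr_mono[of "1 / p" 1 ?z] z p by (intro mult_right_mono) auto
    also have "\<dots> = quantization_rate p d n"
      using 3 by (simp add: quantization_rate_def)
    finally show ?thesis .
  qed
qed

section \<open>Rate of quantization by empirical measures\<close>

theorem theorem3p3:
  fixes \<rho> :: "(real ^ 'd::finite) measure" and r :: real
  assumes "r \<ge> 0"
    and "prob_space \<rho>" and "sets \<rho> = sets borel"
    and "measure_support \<rho> \<subseteq> max_cball r"
  shows "\<forall>n::nat. n \<ge> 1 \<longrightarrow>
    (\<exists>x :: nat \<Rightarrow> real ^ 'd. \<forall>p::real. p \<ge> 1 \<longrightarrow>
      wasserstein p (empirical_measure n x) \<rho>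
        \<le> ennreal (4 * r * quantization_rate p CARD('d) n))"
proof (intro allI impI)
  fix n :: nat
  assume n: "n \<ge> 1"
  interpret prob_space \<rho> by fact
  let ?R = "\<lambda>j. 4 * r * real j powr (- 1 / real CARD('d))"
  have "\<exists>\<C> :: nat \<Rightarrow> (real ^ 'd) set set. \<forall>j\<in>{0<..}. finite (\<C> j) \<and> card (\<C> j) \<le> j \<and>
      \<C> j \<subseteq> sets borel \<and> max_cball r \<subseteq> \<Union>(\<C> j) \<and>
      (\<forall>C\<in>\<C> j. \<exists>x. \<forall>y\<in>C. infnorm (x - y) \<le> ?R j)"
    by (intro bchoice ballI cube_cover assms(1)) simp
  then obtain \<C> :: "nat \<Rightarrow> (real ^ 'd) set set" where *: "\<forall>j\<in>{0<..}. finite (\<C> j) \<and>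
      card (\<C> j) \<le> j \<and> \<C> j \<subseteq> sets borel \<and> max_cball r \<subseteq> \<Union>(\<C> j) \<and>
      (\<forall>C\<in>\<C> j. \<exists>x. \<forall>y\<in>C. infnorm (x - y) \<le> ?R j)"
    by (rule exE)
  have \<C>: "finite (\<C> j)" "card (\<C> j) \<le> j" "\<C> j \<subseteq> sets \<rho>" "max_cball r \<subseteq> \<Union>(\<C> j)"
    "\<forall>C\<in>\<C> j. \<exists>x. \<forall>y\<in>C. infnorm (x - y) \<le> ?R j" if "j > 0" for j
    unfolding assms(3) using bspec[OF *, of j] that by simp_all
  have in_ball: "AE y in \<rho>. y \<in> max_cball r"
    using AE_in_measure_support[OF assms(3)] by eventually_elim (use assms(4) in blast)
  then have cover: "AE y in \<rho>. y \<in> \<Union>(\<C> j)" if "j > 0" for j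
    using in_ball by eventually_elim (use \<C>(4)[OF that] in blast)
  have mass: "integral\<^sup>N \<rho> (\<lambda>y. 1) = of_nat n * ennreal (1 / real n)"
    using n by (simp add: emeasure_space_1 ennreal_of_nat_eq_real_of_nat flip: ennreal_mult)
  have mass_pos: "1 / real n > 0" using n by simp
  have "\<exists>C g. (AE y in \<rho>. 1 = (\<Sum>j=1..n. g j y)) \<and>
    (\<forall>j\<in>{1..n}. C j \<in> \<C> j \<and> g j \<in> borel_measurable \<rho> \<and>
      integral\<^sup>N \<rho> (g j) = ennreal (1 / real n) \<and> (\<forall>y. y \<notin> C j \<longrightarrow> g j y = 0))"
    by (rule uniform_decomposition[OF \<C>(1-3) cover mass_pos borel_measurable_const mass])
  then obtain C g where
    sum_g: "AE y in \<rho>. 1 = (\<Sum>j=1..n. g j y)" and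
    pieces: "\<forall>j\<in>{1..n}. C j \<in> \<C> j \<and> g j \<in> borel_measurable \<rho> \<and>
      integral\<^sup>N \<rho> (g j) = ennreal (1 / real n) \<and> (\<forall>y. y \<notin> C j \<longrightarrow> g j y = 0)"
    by (elim exE conjE)
  have Cg: "C j \<in> \<C> j" "g j \<in> borel_measurable \<rho>" "integral\<^sup>N \<rho> (g j) = ennreal (1 / real n)"
    "\<And>y. y \<notin> C j \<Longrightarrow> g j y = 0" if "j \<in> {1..n}" for j
    using bspec[OF pieces that] by blast+
  have "\<forall>j\<in>{1..n}. \<exists>x. \<forall>y\<in>C j. infnorm (x - y) \<le> ?R j"
  proof
    fix j assume "j \<in> {1..n}"
    with Cg(1)[of j] \<C>(5)[of j] show "\<exists>x. \<forall>y\<in>C j. infnorm (x - y) \<le> ?R j" by simp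
  qed
  then obtain x where "\<forall>j\<in>{1..n}. \<forall>y\<in>C j. infnorm (x j - y) \<le> ?R j"
    using bchoice[of "{1..n}" "\<lambda>j x. \<forall>y\<in>C j. infnorm (x - y) \<le> ?R j"] by blast
  then have x: "\<And>j y. j \<in> {1..n} \<Longrightarrow> y \<in> C j \<Longrightarrow> infnorm (x j - y) \<le> ?R j"
    by blast
  have "AE y in \<rho>. (\<Sum>j=1..n. g j y) = 1"
    using sum_g by eventually_elim simp
  from nn_integral_empirical_coupling[OF assms(2,3) Cg(2,3) this, of x]
  obtain \<pi> where \<pi>: "\<pi> \<in> couplings (empirical_measure n x) \<rho>" and
    int_\<pi>: "\<And>f. f \<in> borel_measurable (borel \<Otimes>\<^sub>M borel) \<Longrightarrow>
      integral\<^sup>N \<pi> f = (\<Sum>j=1..n. \<integral>\<^sup>+y. f (x j, y) * g j y \<partial>\<rho>)"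
    by blast
  show "\<exists>x :: nat \<Rightarrow> real ^ 'd. \<forall>p::real. p \<ge> 1 \<longrightarrow>
      wasserstein p (empirical_measure n x) \<rho> \<le> ennreal (4 * r * quantization_rate p CARD('d) n)"
  proof (intro exI[of _ x] allI impI)
    fix p :: real
    assume p: "p \<ge> 1"
    let ?S = "\<Sum>j=1..n. real j powr (- (p / real CARD('d)))"
    let ?b = "(4 * r) powr p * (?S / real n)"
    have S: "?S \<ge> 0" by (intro sum_nonneg) auto
    have "(\<lambda>z :: (real ^ 'd) \<times> (real ^ 'd). infnorm (fst z - snd z)) \<in> borel_measurable borel"
      by (intro borel_measurable_continuous_onI continuous_intros)
    then have [measurable]: "(\<lambda>(x :: real ^ 'd, y). ennreal (infnorm (x - y) powr p))
        \<in> borel_measurable (borel \<Otimes>\<^sub>M borel)"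
      by (simp add: borel_prod split_beta)
    have "(\<integral>\<^sup>+ (x, y). ennreal (infnorm (x - y) powr p) \<partial>\<pi>)
        = (\<Sum>j=1..n. \<integral>\<^sup>+y. ennreal (infnorm (x j - y) powr p) * g j y \<partial>\<rho>)"
      by (subst int_\<pi>) auto
    also have "\<dots> \<le> (\<Sum>j=1..n. \<integral>\<^sup>+y. ennreal (?R j powr p) * g j y \<partial>\<rho>)"
    proof (intro sum_mono nn_integral_mono)
      fix j y
      assume j: "j \<in> {1..n}"
      show "ennreal (infnorm (x j - y) powr p) * g j y \<le> ennreal (?R j powr p) * g j y"
      proof (cases "y \<in> C j")
        case True
        then show ?thesis
          using x[OF j True] p
          by (intro mult_right_mono ennreal_leI powr_mono2) (auto simp: infnorm_pos_le)
      qed (simp add: Cg(4)[OF j])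
    qed
    also have "\<dots> = (\<Sum>j=1..n. ennreal (?R j powr p * (1 / real n)))"
      using Cg(2,3) by (intro sum.cong refl) (simp add: nn_integral_cmult flip: ennreal_mult)
    also have "\<dots> = ennreal (\<Sum>j=1..n. ?R j powr p * (1 / real n))"
      by (intro sum_ennreal) auto
    also have "(\<Sum>j=1..n. ?R j powr p * (1 / real n)) = ?b"
      using assms(1)
      by (simp add: powr_mult powr_powr sum_distrib_left sum_divide_distrib mult.commute)
    finally have "wasserstein p (empirical_measure n x) \<rho> \<le> ennreal (?b powr (1 / p))"
      using p S by (intro wasserstein_le_of_coupling[OF \<pi>]) auto
    also have "?b powr (1 / p) = 4 * r * (?S / real n) powr (1 / p)"
      using p S assms(1) by (subst powr_mult) (auto simp: powr_powr)
    also have "ennreal \<dots> \<le> ennreal (4 * r * quantization_rate p CARD('d) n)"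
      using assms(1) p n by (intro ennreal_leI mult_left_mono root_mean_le_quantization_rate) auto
    finally show "wasserstein p (empirical_measure n x) \<rho>
        \<le> ennreal (4 * r * quantization_rate p CARD('d) n)" .
  qed
qed

end
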